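(* Let $E$ be an atomless Dedekind complete vector lattice and $F$ a Banach space. Then every orthogonally additive laterally-to-norm continuous $C$-compact operator $T: E \to F$ is narrow.
   Context: Vector lattices and Banach spaces are real. In a vector lattice $E$, an element $u>0$ is an atom if $0\le x\le u$, $0\le y\le u$, $x\wedge y=0$ imply $x=0$ or $y=0$; $E$ is atomless if it has no atom. For $x,y\in E$, $x\perp y$ means $|x|\wedge|y|=0$. An element $y\in E$ is a fragment of $x\in E$, written $y\sqsubseteq x$, if $y\perp(x-y)$. The notation $x=x_1\sqcup x_2$ means $x=x_1+x_2$ and $x_1\perp x_2$; then $x_1,x_2$ are called mutually complemented (MC) fragments of $x$. A net $(x_\alpha)$ in $E$ order converges to $x$ if there is a net $(u_\alpha)$ in $E$ with the same index set such that $u_\alpha\downarrow 0$ and $|x_\alpha-x|\le u_\alpha$ for all $\alpha$. It laterally converges to $x$ if $x_\alpha\sqsubseteq x_\beta\sqsubseteq x$ for all indices $\alpha<\beta$ and $x_\alpha$ order converges to $x$. Let $X$ be a Banach space. A (not necessarily linear) map $T:E\to X$ is: - orthogonally additive if $T(x+y)=T(x)+T(y)$ whenever $x\perp y$; - laterally-to-norm continuous if $\|T(x_\alpha)-T(x)\|\to0$ whenever the net $(x_\alpha)$ laterally converges to $x$; - $C$-compact if the set $\{T(y): y\sqsubseteq x\}$ is relatively compact in $X$ for every $x\in E$; - narrow if for every $e\in E$ and every $\varepsilon>0$ there exist MC fragments $e_1,e_2$ of $e$ with $\|T(e_1)-T(e_2)\|<\varepsilon$. *)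

theory Defs
  imports "HOL-Analysis.Analysis" "HOL-Library.Lattice_Algebras"
begin

section \<open>Vector lattices\<close>

class vector_lattice = ordered_real_vector + lattice_ab_group_add_abs

class dedekind_complete_vector_lattice = vector_lattice + conditionally_complete_lattice

definition is_atom :: "'a::vector_lattice \<Rightarrow> bool" where
  "is_atom u \<longleftrightarrow> 0 < u \<and>
    (\<forall>x y. 0 \<le> x \<and> x \<le> u \<and> 0 \<le> y \<and> y \<le> u \<and> inf x y = 0 \<longrightarrow> x = 0 \<or> y = 0)"

definition lat_disjoint :: "'a::vector_lattice \<Rightarrow> 'a \<Rightarrow> bool" where
  "lat_disjoint x y \<longleftrightarrow> inf \<bar>x\<bar> \<bar>y\<bar> = 0"

definition fragment_of :: "'a::vector_lattice \<Rightarrow> 'a \<Rightarrow> bool" where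
  "fragment_of y x \<longleftrightarrow> lat_disjoint y (x - y)"

definition mc_fragments :: "'a::vector_lattice \<Rightarrow> 'a \<Rightarrow> 'a \<Rightarrow> bool" where
  "mc_fragments x x1 x2 \<longleftrightarrow> x = x1 + x2 \<and> lat_disjoint x1 x2"


section \<open>Nets\<close>

text \<open>A net is a function on the carrier \<open>I\<close> of a directed preorder \<open>le\<close>. If \<open>le\<close> is a partial
  order, the strict part below is just \<open>le a b\<close> with \<open>a \<noteq> b\<close>.\<close>

definition directed_index :: "'i set \<Rightarrow> ('i \<Rightarrow> 'i \<Rightarrow> bool) \<Rightarrow> bool" where
  "directed_index I le \<longleftrightarrow> I \<noteq> {} \<and>
    (\<forall>a\<in>I. le a a) \<and>
    (\<forall>a\<in>I. \<forall>b\<in>I. \<forall>c\<in>I. le a b \<and> le b c \<longrightarrow> le a c) \<and>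
    (\<forall>a\<in>I. \<forall>b\<in>I. \<exists>c\<in>I. le a c \<and> le b c)"

definition strict_index :: "('i \<Rightarrow> 'i \<Rightarrow> bool) \<Rightarrow> 'i \<Rightarrow> 'i \<Rightarrow> bool" where
  "strict_index le a b \<longleftrightarrow> le a b \<and> \<not> le b a"

definition net_filter :: "'i set \<Rightarrow> ('i \<Rightarrow> 'i \<Rightarrow> bool) \<Rightarrow> 'i filter" where
  "net_filter I le = (INF a\<in>I. principal {b \<in> I. le a b})"

definition net_decreases_to_0 ::
    "'i set \<Rightarrow> ('i \<Rightarrow> 'i \<Rightarrow> bool) \<Rightarrow> ('i \<Rightarrow> 'a::vector_lattice) \<Rightarrow> bool" where
  "net_decreases_to_0 I le u \<longleftrightarrow>
    (\<forall>a\<in>I. \<forall>b\<in>I. le a b \<longrightarrow> u b \<le> u a) \<and>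
    (\<forall>a\<in>I. 0 \<le> u a) \<and> (\<forall>z. (\<forall>a\<in>I. z \<le> u a) \<longrightarrow> z \<le> 0)"

definition order_converges ::
    "'i set \<Rightarrow> ('i \<Rightarrow> 'i \<Rightarrow> bool) \<Rightarrow> ('i \<Rightarrow> 'a::vector_lattice) \<Rightarrow> 'a \<Rightarrow> bool" where
  "order_converges I le x l \<longleftrightarrow>
    (\<exists>u. net_decreases_to_0 I le u \<and> (\<forall>a\<in>I. \<bar>x a - l\<bar> \<le> u a))"

definition laterally_converges ::
    "'i set \<Rightarrow> ('i \<Rightarrow> 'i \<Rightarrow> bool) \<Rightarrow> ('i \<Rightarrow> 'a::vector_lattice) \<Rightarrow> 'a \<Rightarrow> bool" where
  "laterally_converges I le x l \<longleftrightarrow>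
    (\<forall>a\<in>I. \<forall>b\<in>I. strict_index le a b \<longrightarrow> fragment_of (x a) (x b) \<and> fragment_of (x b) l) \<and>
    order_converges I le x l"


section \<open>Operators\<close>

definition orthogonally_additive :: "('a::vector_lattice \<Rightarrow> 'b::real_normed_vector) \<Rightarrow> bool" where
  "orthogonally_additive T \<longleftrightarrow> (\<forall>x y. lat_disjoint x y \<longrightarrow> T (x + y) = T x + T y)"

text \<open>HOL cannot quantify over all index types inside a formula, so the index sets are taken to be
  all subsets of the lattice itself, with arbitrary directed preorders. Nothing is lost: by
  \<open>laterally_to_norm_continuousD\<close> below, the property extends to nets over any index type.\<close>

definition laterally_to_norm_continuous ::
    "('a::vector_lattice \<Rightarrow> 'b::real_normed_vector) \<Rightarrow> bool" where
  "laterally_to_norm_continuous T \<longleftrightarrow>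
    (\<forall>(I :: 'a set) le x l. directed_index I le \<and> laterally_converges I le x l \<longrightarrow>
      ((\<lambda>a. norm (T (x a) - T l)) \<longlongrightarrow> 0) (net_filter I le))"

definition C_compact :: "('a::vector_lattice \<Rightarrow> 'b::real_normed_vector) \<Rightarrow> bool" where
  "C_compact T \<longleftrightarrow> (\<forall>x. compact (closure {T y | y. fragment_of y x}))"

definition narrow :: "('a::vector_lattice \<Rightarrow> 'b::real_normed_vector) \<Rightarrow> bool" where
  "narrow T \<longleftrightarrow>
    (\<forall>e. \<forall>\<epsilon>>0. \<exists>e1 e2. mc_fragments e e1 e2 \<and> norm (T e1 - T e2) < \<epsilon>)"


section \<open>Independence of the index type\<close>

lemma eventually_net_filter:
  assumes "directed_index I le"
  shows "eventually P (net_filter I le) \<longleftrightarrow> (\<exists>a\<in>I. \<forall>b\<in>I. le a b \<longrightarrow> P b)"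
proof -
  have "eventually P (net_filter I le) \<longleftrightarrow>
      (\<exists>a\<in>I. eventually P (principal {b \<in> I. le a b}))"
    unfolding net_filter_def
  proof (rule eventually_INF_base)
    show "I \<noteq> {}" using assms by (simp add: directed_index_def)
    fix a b assume ab: "a \<in> I" "b \<in> I"
    then obtain c where c: "c \<in> I" "le a c" "le b c"
      using assms unfolding directed_index_def by meson
    have "{d \<in> I. le c d} \<subseteq> {d \<in> I. le a d} \<inter> {d \<in> I. le b d}"
      using assms ab c unfolding directed_index_def by blast
    with c show "\<exists>x\<in>I. principal {d \<in> I. le x d} \<le>
        inf (principal {b \<in> I. le a b}) (principal {d \<in> I. le b d})"
      by auto
  qed
  then show ?thesis by (auto simp: eventually_principal)
qed

lemma inf_add_le:
  fixes a b c :: "'a::vector_lattice"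
  assumes "0 \<le> a" "0 \<le> b" "0 \<le> c"
  shows "inf a (b + c) \<le> inf a b + inf a c"
proof -
  have a: "inf a (b + c) \<le> a" and bc: "inf a (b + c) \<le> b + c" by auto
  have "a \<le> a + a" "a \<le> b + a" "a \<le> a + c" using assms by auto
  with a have "inf a (b + c) \<le> a + a" "inf a (b + c) \<le> b + a" "inf a (b + c) \<le> a + c"
    by (meson order_trans)+
  with bc show ?thesis
    by (simp add: add_inf_distrib_left add_inf_distrib_right)
qed

lemma lat_disjoint_sym: "lat_disjoint x y \<Longrightarrow> lat_disjoint y x"
  by (simp add: lat_disjoint_def inf_commute)

lemma lat_disjoint_mono:
  fixes x y z :: "'a::vector_lattice"
  assumes "lat_disjoint x y" "\<bar>z\<bar> \<le> \<bar>y\<bar>"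
  shows "lat_disjoint x z"
proof -
  have "inf \<bar>x\<bar> \<bar>z\<bar> \<le> inf \<bar>x\<bar> \<bar>y\<bar>" using assms(2) by (rule inf_mono[OF order_refl])
  moreover have "0 \<le> inf \<bar>x\<bar> \<bar>z\<bar>" by simp
  ultimately show ?thesis using assms(1) unfolding lat_disjoint_def by (metis order.antisym)
qed

lemma lat_disjoint_add:
  fixes x y z :: "'a::vector_lattice"
  assumes "lat_disjoint x y" "lat_disjoint x z"
  shows "lat_disjoint x (y + z)"
proof -
  have "inf \<bar>x\<bar> \<bar>y + z\<bar> \<le> inf \<bar>x\<bar> (\<bar>y\<bar> + \<bar>z\<bar>)"
    by (rule inf_mono[OF order_refl abs_triangle_ineq])
  also have "\<dots> \<le> inf \<bar>x\<bar> \<bar>y\<bar> + inf \<bar>x\<bar> \<bar>z\<bar>" by (rule inf_add_le) auto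
  also have "\<dots> = 0" using assms by (simp add: lat_disjoint_def)
  finally have "inf \<bar>x\<bar> \<bar>y + z\<bar> \<le> 0" .
  moreover have "0 \<le> inf \<bar>x\<bar> \<bar>y + z\<bar>" by simp
  ultimately show ?thesis by (simp add: lat_disjoint_def)
qed

lemma lat_disjoint_abs_le:
  fixes x y :: "'a::vector_lattice"
  assumes "lat_disjoint x y"
  shows "\<bar>x\<bar> \<le> \<bar>x + y\<bar>"
proof -
  have "\<bar>x\<bar> \<le> \<bar>x + y\<bar> + \<bar>y\<bar>"
    using abs_triangle_ineq[of "x + y" "- y"] by simp
  then have "\<bar>x\<bar> = inf \<bar>x\<bar> (\<bar>x + y\<bar> + \<bar>y\<bar>)" by (simp add: inf_absorb1)
  also have "\<dots> \<le> inf \<bar>x\<bar> \<bar>x + y\<bar> + inf \<bar>x\<bar> \<bar>y\<bar>" by (rule inf_add_le) auto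
  also have "\<dots> = inf \<bar>x\<bar> \<bar>x + y\<bar>" using assms by (simp add: lat_disjoint_def)
  finally show ?thesis by simp
qed

lemma fragment_of_refl: "fragment_of x (x::'a::vector_lattice)"
  by (simp add: fragment_of_def lat_disjoint_def inf_absorb2)

lemma fragment_of_abs_le:
  fixes x y :: "'a::vector_lattice"
  assumes "fragment_of y x"
  shows "\<bar>y\<bar> \<le> \<bar>x\<bar>" "\<bar>x - y\<bar> \<le> \<bar>x\<bar>"
  using lat_disjoint_abs_le[of y "x - y"] lat_disjoint_abs_le[of "x - y" y]
    lat_disjoint_sym[of y "x - y"] assms
  by (auto simp: fragment_of_def)

lemma fragment_of_trans:
  fixes x y z :: "'a::vector_lattice"
  assumes "fragment_of x y" "fragment_of y z"
  shows "fragment_of x z"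
proof -
  have "lat_disjoint (z - y) x"
    using assms(2) fragment_of_abs_le(1)[OF assms(1)]
    by (auto simp: fragment_of_def intro: lat_disjoint_mono lat_disjoint_sym)
  then have "lat_disjoint x ((z - y) + (y - x))"
    using assms(1) unfolding fragment_of_def by (blast intro: lat_disjoint_add lat_disjoint_sym)
  then show ?thesis by (simp add: fragment_of_def)
qed

lemma fragment_of_dist_mono:
  fixes x y z :: "'a::vector_lattice"
  assumes "fragment_of x y" "fragment_of y z"
  shows "\<bar>y - z\<bar> \<le> \<bar>x - z\<bar>"
proof -
  have "lat_disjoint (z - y) (y - x)"
    using assms(2) fragment_of_abs_le(2)[OF assms(1)]
    by (auto simp: fragment_of_def intro: lat_disjoint_mono lat_disjoint_sym)
  from lat_disjoint_abs_le[OF this] show ?thesis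
    by (simp add: abs_minus_commute)
qed

lemma laterally_to_norm_continuousD:
  fixes T :: "'a::vector_lattice \<Rightarrow> 'b::real_normed_vector" and I :: "'i set"
  assumes T: "laterally_to_norm_continuous T"
    and dir: "directed_index I le" and conv: "laterally_converges I le x l"
  shows "((\<lambda>a. norm (T (x a) - T l)) \<longlongrightarrow> 0) (net_filter I le)"
proof -
  obtain u where u: "net_decreases_to_0 I le u" "\<And>a. a \<in> I \<Longrightarrow> \<bar>x a - l\<bar> \<le> u a"
    using conv by (auto simp: laterally_converges_def order_converges_def)
  have lat: "fragment_of (x a) (x b)" "fragment_of (x b) l"
    if "a \<in> I" "b \<in> I" "strict_index le a b" for a b
    using conv that by (auto simp: laterally_converges_def)
  have refl: "le a a" if "a \<in> I" for a using dir that by (auto simp: directed_index_def)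
  have trans: "le a c" if "a \<in> I" "b \<in> I" "c \<in> I" "le a b" "le b c" for a b c
    using dir that unfolding directed_index_def by blast
  have ub: "\<exists>c\<in>I. le a c \<and> le b c" if "a \<in> I" "b \<in> I" for a b
    using dir that unfolding directed_index_def by blast
  show ?thesis
  proof (cases "\<exists>t\<in>I. \<forall>a\<in>I. le a t")
    case True
    then obtain t where t: "t \<in> I" "\<And>a. a \<in> I \<Longrightarrow> le a t" by blast
    have "x b = l" if b: "b \<in> I" "le t b" for b
    proof -
      have "u b \<le> u a" if "a \<in> I" for a
        using u(1) b t that trans unfolding net_decreases_to_0_def by blast
      then have "u b \<le> 0" using u(1) by (auto simp: net_decreases_to_0_def)
      with u(2)[OF b(1)] have "\<bar>x b - l\<bar> \<le> 0" by (rule order_trans)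
      then show ?thesis by simp
    qed
    then have "eventually (\<lambda>a. norm (T (x a) - T l) = 0) (net_filter I le)"
      unfolding eventually_net_filter[OF dir] using t(1) by auto
    then show ?thesis by (rule tendsto_eventually)
  next
    case False
    have above: "\<exists>c\<in>I. strict_index le a c \<and> strict_index le b c" if ab: "a \<in> I" "b \<in> I" for a b
    proof -
      obtain c where c: "c \<in> I" "le a c" "le b c" using ub ab by blast
      obtain d where d: "d \<in> I" "\<not> le d c" using False c(1) by blast
      obtain e where e: "e \<in> I" "le c e" "le d e" using ub c(1) d(1) by blast
      have "\<not> le e c" using trans d e c(1) by blast
      then have "strict_index le a e" "strict_index le b e"
        using trans ab c e unfolding strict_index_def by blast+
      with e(1) show ?thesis by blast
    qed
    have frag: "fragment_of (x a) l" if "a \<in> I" for a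
      using above[OF that that] lat fragment_of_trans that by blast
    let ?D = "x ` I"
    have dirD: "directed_index ?D fragment_of"
      unfolding directed_index_def
    proof (intro conjI ballI impI)
      show "?D \<noteq> {}" using dir by (simp add: directed_index_def)
    next
      fix a b assume "a \<in> ?D" "b \<in> ?D"
      then obtain i j where ij: "i \<in> I" "j \<in> I" "a = x i" "b = x j" by blast
      then show "\<exists>c\<in>?D. fragment_of a c \<and> fragment_of b c" using above[of i j] lat by blast
    qed (auto simp: fragment_of_refl intro: fragment_of_trans)
    have "net_decreases_to_0 ?D fragment_of (\<lambda>d. \<bar>d - l\<bar>)"
      unfolding net_decreases_to_0_def
    proof (intro conjI ballI impI allI)
      fix a b assume "b \<in> ?D" "fragment_of a b"
      then show "\<bar>b - l\<bar> \<le> \<bar>a - l\<bar>" using frag fragment_of_dist_mono by blast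
    next
      fix z assume "\<forall>a\<in>?D. z \<le> \<bar>a - l\<bar>"
      then have "\<forall>a\<in>I. z \<le> u a" using u(2) by (meson imageI order_trans)
      then show "z \<le> 0" using u(1) by (auto simp: net_decreases_to_0_def)
    qed auto
    then have "laterally_converges ?D fragment_of (\<lambda>d. d) l"
      using frag unfolding laterally_converges_def order_converges_def strict_index_def by auto
    with T dirD have lim: "((\<lambda>d. norm (T d - T l)) \<longlongrightarrow> 0) (net_filter ?D fragment_of)"
      unfolding laterally_to_norm_continuous_def by blast
    have "filterlim x (net_filter ?D fragment_of) (net_filter I le)"
      unfolding filterlim_iff eventually_net_filter[OF dir] eventually_net_filter[OF dirD]
    proof (intro allI impI)
      fix P assume "\<exists>d\<in>?D. \<forall>b\<in>?D. fragment_of d b \<longrightarrow> P b"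
      then obtain i where i: "i \<in> I" "\<And>j. j \<in> I \<Longrightarrow> fragment_of (x i) (x j) \<Longrightarrow> P (x j)" by blast
      obtain k where k: "k \<in> I" "strict_index le i k" using above i(1) by blast
      have "P (x j)" if j: "j \<in> I" "le k j" for j
      proof -
        have "strict_index le i j" using k i(1) j trans unfolding strict_index_def by blast
        then show ?thesis using i j lat by blast
      qed
      with k(1) show "\<exists>a\<in>I. \<forall>b\<in>I. le a b \<longrightarrow> P (x b)" by blast
    qed
    from filterlim_compose[OF lim this] show ?thesis .
  qed
qed

end

theory Submission
  imports Defs
begin

text \<open>The components of \<open>\<bar>e\<bar>\<close> correspond to the fragments of \<open>e\<close>, and \<open>T\<close> becomes an order
  continuous additive function \<open>S\<close> on this atomless Boolean algebra. An ultrafilter argument splits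
  \<open>\<bar>e\<bar>\<close> into finitely many components on which \<open>S\<close> is uniformly small. Since \<open>S\<close> has a relatively
  compact range, finitely many norm-one functionals \<open>f\<close> detect the norm of the differences
  \<open>S a - S (\<bar>e\<bar> - a)\<close> up to \<open>\<epsilon> / 2\<close>. Each \<open>f \<circ> S\<close> is bounded, hence of bounded
  variation on the pieces, so a greedy choice of signs makes the sum of the squares
  \<open>(f (S a - S (\<bar>e\<bar> - a)))\<^sup>2\<close> at most a constant times the size of \<open>S\<close> on the pieces.\<close>

section \<open>Components\<close>

text \<open>The single equation already forces \<open>0 \<le> a\<close> and
  \<open>a \<le> u\<close>, so no absolute values or sign conditions have to be carried
  along.\<close>

definition lat_components :: "'a::vector_lattice \<Rightarrow> 'a set" where
  "lat_components u = {a. inf a (u - a) = 0}"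

lemma inf_zeroD:
  fixes x y :: "'a::vector_lattice"
  assumes "inf x y = 0"
  shows "0 \<le> x" "0 \<le> y"
  using inf.cobounded1[of x y] inf.cobounded2[of x y] by (simp_all only: assms)

lemma lat_componentsD:
  assumes "a \<in> lat_components u"
  shows "0 \<le> a" "a \<le> u" "inf a (u - a) = 0"
proof -
  show *: "inf a (u - a) = 0" using assms by (simp add: lat_components_def)
  show "0 \<le> a" "a \<le> u" using inf_zeroD[OF *] by auto
qed

lemma zero_in_lat_components: "0 \<le> u \<Longrightarrow> 0 \<in> lat_components u"
  by (simp add: lat_components_def inf_absorb1)

lemma self_in_lat_components: "0 \<le> u \<Longrightarrow> u \<in> lat_components u"
  by (simp add: lat_components_def inf_absorb2)

lemma diff_in_lat_components: "a \<in> lat_components u \<Longrightarrow> u - a \<in> lat_components u"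
  by (simp add: lat_components_def inf_commute)

section \<open>Arithmetic of disjoint positive elements\<close>

lemma inf_zero_mono:
  fixes x y z w :: "'a::vector_lattice"
  assumes "inf x y = 0" "0 \<le> z" "z \<le> x" "0 \<le> w" "w \<le> y"
  shows "inf z w = 0"
proof (rule order.antisym)
  show "inf z w \<le> 0" using inf_mono[OF assms(3,5)] assms(1) by simp
qed (simp add: assms)

lemma inf_zero_add:
  fixes x y z :: "'a::vector_lattice"
  assumes "inf x y = 0" "inf x z = 0"
  shows "inf x (y + z) = 0"
proof -
  have nn: "0 \<le> x" "0 \<le> y" "0 \<le> z"
    using assms inf_zeroD by blast+
  show ?thesis
    using inf_add_le[OF nn] assms nn by (simp add: order.antisym)
qed

lemma add_eq_sup_of_disjoint:
  fixes x y :: "'a::vector_lattice"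
  shows "inf x y = 0 \<Longrightarrow> x + y = sup x y"
  using add_eq_inf_sup[of x y] by simp

lemma add_le_of_disjoint:
  fixes x y z :: "'a::vector_lattice"
  assumes "inf x y = 0" "x \<le> z" "y \<le> z"
  shows "x + y \<le> z"
  using assms by (simp add: add_eq_sup_of_disjoint)

text \<open>\<open>inf c a\<close> and \<open>inf c b\<close> are again disjoint, so their sum is
  their supremum and stays below \<open>c\<close>; this improves subadditivity to equality.\<close>

lemma inf_add_disjoint:
  fixes a b c :: "'a::vector_lattice"
  assumes "inf a b = 0" "0 \<le> c"
  shows "inf c (a + b) = inf c a + inf c b"
proof (rule order.antisym)
  have nn: "0 \<le> a" "0 \<le> b" using inf_zeroD[OF assms(1)] by auto
  show "inf c (a + b) \<le> inf c a + inf c b" using inf_add_le assms(2) nn by blast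
  have "inf (inf c a) (inf c b) = 0"
    by (rule inf_zero_mono[OF assms(1)]) (use assms(2) nn in auto)
  then show "inf c a + inf c b \<le> inf c (a + b)"
    using nn by (intro add_le_of_disjoint) (auto intro: le_infI2 add_increasing add_increasing2)
qed

section \<open>The Boolean algebra of components\<close>

lemma lat_components_split:
  assumes "a \<in> lat_components u" "0 \<le> c" "c \<le> u"
  shows "inf c a + inf c (u - a) = c"
  using inf_add_disjoint[OF lat_componentsD(3)[OF assms(1)] assms(2)] assms(3)
  by (simp add: inf_absorb1)

text \<open>De Morgan: the complement of \<open>inf a b\<close> is the supremum of the two
  complements, hence lies below their sum, and \<open>inf a b\<close> is disjoint from each of
  them.\<close>

lemma inf_in_lat_components:
  assumes a: "a \<in> lat_components u" and b: "b \<in> lat_components u"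
  shows "inf a b \<in> lat_components u"
proof -
  note c = lat_componentsD[OF a] lat_componentsD[OF b]
  have "inf (inf a b) (u - a) = 0" "inf (inf a b) (u - b) = 0"
    by (rule inf_zero_mono[OF c(3)], use c in auto)
       (rule inf_zero_mono[OF c(6)], use c in auto)
  then have *: "inf (inf a b) ((u - a) + (u - b)) = 0" by (rule inf_zero_add)
  have "u - inf a b = sup (u - a) (u - b)"
    by (simp add: add_sup_distrib_left)
  also have "\<dots> \<le> (u - a) + (u - b)"
    using c by (intro sup_least) auto
  finally have "u - inf a b \<le> (u - a) + (u - b)" .
  from inf_zero_mono[OF * _ _ _ this] show ?thesis
    using c by (simp add: lat_components_def le_infI1 del: diff_inf_eq_sup)
qed

lemma lat_components_trans:
  assumes a: "a \<in> lat_components b" and b: "b \<in> lat_components u"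
  shows "a \<in> lat_components u"
proof -
  note c = lat_componentsD[OF a] lat_componentsD[OF b]
  have "inf a (u - b) = 0" by (rule inf_zero_mono[OF c(6)]) (use c in auto)
  from inf_zero_add[OF this c(3)] show ?thesis by (simp add: lat_components_def)
qed

lemma add_in_lat_components:
  assumes a: "a \<in> lat_components x" and b: "b \<in> lat_components y" and xy: "inf x y = 0"
  shows "a + b \<in> lat_components (x + y)"
proof -
  note c = lat_componentsD[OF a] lat_componentsD[OF b]
  have 1: "inf a (y - b) = 0" "inf b (x - a) = 0"
    by (rule inf_zero_mono[OF xy], use c in auto)
       (subst inf_commute, rule inf_zero_mono[OF xy], use c in auto)
  have "inf (a + b) (x - a) = 0" "inf (a + b) (y - b) = 0"
    using inf_zero_add[of "x - a" a b] inf_zero_add[of "y - b" a b] 1 c(3,6)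
    by (simp_all only: inf_commute)
  then have "inf (a + b) ((x - a) + (y - b)) = 0" by (rule inf_zero_add)
  moreover have "(x - a) + (y - b) = (x + y) - (a + b)" by (rule add_diff_add[symmetric])
  ultimately show ?thesis unfolding lat_components_def by (simp only: mem_Collect_eq)
qed

text \<open>The supremum \<open>b\<close> of all \<open>a \<le> u\<close> disjoint from \<open>y\<close> is a component: if
  \<open>c = inf b (u - b)\<close>, then \<open>b + c\<close> competes in the supremum.\<close>

lemma not_atom_split:
  fixes u :: "'a::dedekind_complete_vector_lattice"
  assumes "0 < u" "\<not> is_atom u"
  obtains b where "b \<in> lat_components u" "b \<noteq> 0" "b \<noteq> u"
proof -
  obtain x y where xy: "0 \<le> x" "x \<le> u" "0 \<le> y" "y \<le> u" "inf x y = 0" "x \<noteq> 0" "y \<noteq> 0"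
    using assms unfolding is_atom_def by blast
  define A where "A = {a. 0 \<le> a \<and> a \<le> u \<and> inf a y = 0}"
  define b where "b = Sup A"
  have xA: "x \<in> A" using xy by (simp add: A_def)
  have bdd: "bdd_above A" by (auto simp: A_def bdd_above_def)
  have ub: "a \<le> b" if "a \<in> A" for a unfolding b_def by (rule cSup_upper[OF that bdd])
  have b_le: "b \<le> z" if "\<And>a. a \<in> A \<Longrightarrow> a \<le> z" for z
    unfolding b_def by (rule cSup_least) (use xA that in auto)
  have b0: "0 \<le> b" "b \<le> u" using ub[OF xA] xy(1) b_le by (auto simp: A_def)
  have disj: "inf b y = 0"
  proof -
    \<comment> \<open>Every \<open>a \<in> A\<close> is disjoint from \<open>inf b y\<close>, so the
      sum of the two is still below \<open>b\<close>. Thus \<open>b - inf b y\<close> bounds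
      \<open>A\<close>, and \<open>inf b y\<close> must vanish.\<close>
    have "b \<le> b - inf b y"
    proof (rule b_le)
      fix a assume a: "a \<in> A"
      have "inf a (inf b y) = 0"
        by (rule inf_zero_mono[of a y]) (use a b0 xy(3) in \<open>auto simp: A_def\<close>)
      then have "a + inf b y \<le> b" using ub[OF a] by (intro add_le_of_disjoint) auto
      then show "a \<le> b - inf b y" by (simp only: le_diff_eq)
    qed
    then have "b + inf b y \<le> b" by (simp only: le_diff_eq)
    then have "inf b y \<le> 0" by simp
    then show ?thesis using b0 xy(3) by (intro order.antisym) auto
  qed
  define c where "c = inf b (u - b)"
  have c: "0 \<le> c" "c \<le> b" "c \<le> u - b" using b0 by (auto simp: c_def)
  have "inf y (b + c) = 0"
  proof (rule inf_zero_add)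
    show yb: "inf y b = 0" using disj by (simp add: inf_commute)
    show "inf y c = 0" by (rule inf_zero_mono[OF yb]) (use c xy in auto)
  qed
  then have "inf (b + c) y = 0" by (simp only: inf_commute)
  moreover have "b + c \<le> u" using c(3) by (simp add: le_diff_eq add.commute)
  ultimately have "b + c \<in> A" using c b0 by (simp add: A_def)
  from ub[OF this] c have "c = 0" by (simp add: order.antisym)
  then have "b \<in> lat_components u" by (simp add: lat_components_def c_def)
  moreover have "b \<noteq> 0" using ub[OF xA] xy(1,6) order.antisym[of x 0] by blast
  moreover have "b \<noteq> u" using disj xy by (auto simp: inf_absorb2)
  ultimately show ?thesis using that by blast
qed

text \<open>Let \<open>c\<close> be the overlap of the infimum \<open>b\<close> with
  \<open>u - b\<close>. For \<open>a \<in> U\<close> both \<open>c\<close> and \<open>u - a\<close>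
  lie below \<open>u - b\<close> and are disjoint, so \<open>c + b \<le> a\<close>. Hence
  \<open>c + b\<close> is a lower bound of \<open>U\<close>, and \<open>c = 0\<close>.\<close>

lemma Inf_in_lat_components:
  fixes u :: "'a::dedekind_complete_vector_lattice"
  assumes U: "U \<subseteq> lat_components u" "U \<noteq> {}"
  shows "Inf U \<in> lat_components u"
proof -
  have bdd: "bdd_below U" by (rule bdd_belowI[of _ 0]) (use U lat_componentsD(1)[of _ u] in auto)
  define b where "b = Inf U"
  have lb: "b \<le> a" if "a \<in> U" for a unfolding b_def by (rule cInf_lower[OF that bdd])
  have le_b: "z \<le> b" if "\<And>a. a \<in> U \<Longrightarrow> z \<le> a" for z
    unfolding b_def by (rule cInf_greatest) (use U that in auto)
  have b0: "0 \<le> b" using U lat_componentsD(1)[of _ u] by (intro le_b) auto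
  obtain a where "a \<in> U" using U(2) by blast
  then have bu: "b \<le> u" using U(1) lb[of a] lat_componentsD(2)[of a u] by auto
  define c where "c = inf b (u - b)"
  have c: "0 \<le> c" "c \<le> b" "c \<le> u - b" using b0 bu by (auto simp: c_def)
  have "c + b \<le> b"
  proof (rule le_b)
    fix a assume a: "a \<in> U"
    then have aC: "a \<in> lat_components u" using U by blast
    have "inf c (u - a) = 0"
      by (rule inf_zero_mono[OF lat_componentsD(3)[OF aC]])
        (use c lb[OF a] lat_componentsD[OF aC] in auto)
    then have "c + (u - a) \<le> u - b"
      using c lb[OF a] by (intro add_le_of_disjoint) auto
    then show "c + b \<le> a" by (simp add: algebra_simps)
  qed
  then have "c = 0" using c by (simp add: order.antisym)
  then show ?thesis by (simp add: lat_components_def c_def b_def)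
qed

section \<open>Splitting into pieces on which the measure is small\<close>

lemma in_lat_components_mono:
  assumes a: "a \<in> lat_components u" and "a \<le> b" "b \<le> u"
  shows "a \<in> lat_components b"
proof -
  have "inf a (b - a) = 0"
    by (rule inf_zero_mono[OF lat_componentsD(3)[OF a]])
      (use assms lat_componentsD[OF a] in auto)
  then show ?thesis by (simp add: lat_components_def)
qed

lemma summand_in_lat_components:
  "inf x y = 0 \<Longrightarrow> x \<in> lat_components (x + y)"
  by (simp add: lat_components_def)

text \<open>Finite disjoint sums of pieces, encoded inductively so that arguments over the number of
  pieces become rule inductions. Smallness is asked of all components of a piece, which makes it
  hereditary.\<close>

inductive finely_divisible :: "('a::vector_lattice \<Rightarrow> 'b::real_normed_vector) \<Rightarrow> real \<Rightarrow> 'a \<Rightarrow> bool"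
  for S d where
  small: "0 \<le> x \<Longrightarrow> (\<And>w. w \<in> lat_components x \<Longrightarrow> norm (S w) \<le> d) \<Longrightarrow> finely_divisible S d x"
| add: "finely_divisible S d x \<Longrightarrow> finely_divisible S d y \<Longrightarrow> inf x y = 0
    \<Longrightarrow> finely_divisible S d (x + y)"

text \<open>Meeting each piece with \<open>c\<close> gives a disjoint decomposition of
  \<open>c\<close> whose pieces are components of the old ones.\<close>

lemma finely_divisible_component:
  assumes "finely_divisible S d x" "c \<in> lat_components x"
  shows "finely_divisible S d c"
  using assms
proof (induction arbitrary: c)
  case (small x)
  then show ?case
    using lat_componentsD(1) lat_components_trans by (blast intro: finely_divisible.small)
next
  case (add x y)
  have x: "x \<in> lat_components (x + y)"
    using add.hyps(3) by (rule summand_in_lat_components)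
  have y: "y \<in> lat_components (x + y)"
    using diff_in_lat_components[OF x] by simp
  have xy: "x \<le> x + y" "y \<le> x + y" using lat_componentsD(2) x y by blast+
  have "finely_divisible S d (inf c x)" "finely_divisible S d (inf c y)"
    using add.IH in_lat_components_mono[OF inf_in_lat_components[OF add.prems x] _ xy(1)]
      in_lat_components_mono[OF inf_in_lat_components[OF add.prems y] _ xy(2)]
    by auto
  moreover have "inf (inf c x) (inf c y) = 0"
    by (rule inf_zero_mono[OF add.hyps(3)])
      (use lat_componentsD(1)[OF add.prems] inf_zeroD[OF add.hyps(3)] in auto)
  moreover have "inf c x + inf c y = c"
    using lat_components_split[OF x lat_componentsD(1,2)[OF add.prems]] by simp
  ultimately show ?case using finely_divisible.add by metis
qed

text \<open>If \<open>u\<close> were not finely divisible, the components that are not would contain an ultrafilter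
  \<open>U\<close> of the Boolean algebra of components. Since there are no atoms, \<open>U\<close> decreases to \<open>0\<close>,
  so \<open>S\<close> is small on \<open>U\<close> below some \<open>y \<in> U\<close>. Every component of \<open>y\<close> or its complement
  in \<open>y\<close> lies in \<open>U\<close>, hence \<open>S\<close> is small on all components of \<open>y\<close>.\<close>

lemma finely_divisible_of_order_continuous:
  fixes u :: "'a::dedekind_complete_vector_lattice" and S :: "'a \<Rightarrow> 'b::real_normed_vector"
  assumes atomless: "\<not> (\<exists>x::'a. is_atom x)" and u: "0 \<le> u" and d: "0 < d"
    and add: "\<And>x y. inf x y = 0 \<Longrightarrow> S (x + y) = S x + S y"
    and cont: "\<And>U \<epsilon>. U \<subseteq> lat_components u \<Longrightarrow> U \<noteq> {} \<Longrightarrow> (\<And>a b. a \<in> U \<Longrightarrow> b \<in> U \<Longrightarrow> inf a b \<in> U) \<Longrightarrow>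
      (\<And>z. (\<And>a. a \<in> U \<Longrightarrow> z \<le> a) \<Longrightarrow> z \<le> 0) \<Longrightarrow> 0 < \<epsilon> \<Longrightarrow>
      \<exists>a\<in>U. \<forall>b\<in>U. b \<le> a \<longrightarrow> norm (S b) < \<epsilon>"
  shows "finely_divisible S d u"
proof (rule ccontr)
  assume bad: "\<not> finely_divisible S d u"
  \<comment> \<open>Families of bad components closed under \<open>inf\<close>; a maximal one,
    supplied by Zorn's lemma, serves as the ultrafilter.\<close>
  define F where "F = {U. u \<in> U \<and> U \<subseteq> lat_components u \<and> (\<forall>a\<in>U. \<forall>b\<in>U. inf a b \<in> U) \<and>
    (\<forall>a\<in>U. \<not> finely_divisible S d a)}"
  have "\<exists>U\<in>F. \<forall>V\<in>F. U \<subseteq> V \<longrightarrow> V = U"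
  proof (rule subset_Zorn_nonempty)
    have "{u} \<in> F" using bad self_in_lat_components[OF u] by (simp add: F_def)
    then show "F \<noteq> {}" by blast
  next
    fix \<C> assume C: "\<C> \<noteq> {}" "subset.chain F \<C>"
    then have CF: "V \<in> F" if "V \<in> \<C>" for V using that by (auto simp: subset_chain_def)
    have "inf a b \<in> \<Union>\<C>" if "a \<in> \<Union>\<C>" "b \<in> \<Union>\<C>" for a b
    proof -
      obtain V W where VW: "V \<in> \<C>" "a \<in> V" "W \<in> \<C>" "b \<in> W" using \<open>a \<in> \<Union>\<C>\<close> \<open>b \<in> \<Union>\<C>\<close> by blast
      then have "V \<subseteq> W \<or> W \<subseteq> V" using C(2) by (auto simp: subset_chain_def)
      then obtain Z where "Z \<in> \<C>" "a \<in> Z" "b \<in> Z" using VW by blast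
      then show ?thesis using CF[of Z] by (auto simp: F_def)
    qed
    moreover have "u \<in> \<Union>\<C>" "\<Union>\<C> \<subseteq> lat_components u" "\<forall>a\<in>\<Union>\<C>. \<not> finely_divisible S d a"
      using C(1) CF unfolding F_def by blast+
    ultimately show "\<Union>\<C> \<in> F" by (simp add: F_def)
  qed
  then obtain U where UF: "U \<in> F" and max: "\<And>V. V \<in> F \<Longrightarrow> U \<subseteq> V \<Longrightarrow> V = U" by blast
  have uU: "u \<in> U" and UC: "U \<subseteq> lat_components u"
    and Uinf: "\<And>a b. a \<in> U \<Longrightarrow> b \<in> U \<Longrightarrow> inf a b \<in> U"
    and Ubad: "\<And>a. a \<in> U \<Longrightarrow> \<not> finely_divisible S d a"
    using UF by (auto simp: F_def)
  \<comment> \<open>Adjoining to \<open>U\<close> the traces \<open>inf v x\<close> stays inside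
    \<open>F\<close>, so by maximality they are in \<open>U\<close> already; \<open>x\<close> itself
    is the trace of \<open>u\<close>.\<close>
  have mem: "x \<in> U" if x: "x \<in> lat_components u"
    and xbad: "\<And>v. v \<in> U \<Longrightarrow> \<not> finely_divisible S d (inf v x)" for x
  proof -
    let ?V = "U \<union> (\<lambda>v. inf v x) ` U"
    have 1: "inf a b \<in> ?V" if "a \<in> U" "b \<in> U" for a b
      using Uinf[OF that] by blast
    have 2: "inf (inf a x) b \<in> ?V" if "a \<in> U" "b \<in> U" for a b
      using imageI[OF Uinf[OF that], of "\<lambda>v. inf v x"] by (simp add: inf.commute inf.left_commute)
    have 3: "inf a (inf b x) \<in> ?V" if "a \<in> U" "b \<in> U" for a b
      using imageI[OF Uinf[OF that], of "\<lambda>v. inf v x"] by (simp add: inf.assoc)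
    have 4: "inf (inf a x) (inf b x) \<in> ?V" if "a \<in> U" "b \<in> U" for a b
      using imageI[OF Uinf[OF that], of "\<lambda>v. inf v x"]
      by (simp add: inf.commute inf.left_commute)
    have "\<forall>a\<in>?V. \<forall>b\<in>?V. inf a b \<in> ?V" using 1 2 3 4 by (simp only: Un_iff image_iff) blast
    moreover have "?V \<subseteq> lat_components u" using UC x inf_in_lat_components by blast
    ultimately have "?V \<in> F" using uU Ubad xbad by (auto simp: F_def)
    then have "?V = U" by (rule max) blast
    moreover have "inf u x = x" using lat_componentsD(2)[OF x] by (rule inf_absorb2)
    ultimately show "x \<in> U" using uU by (metis UnI2 imageI)
  qed
  \<comment> \<open>Otherwise some \<open>v\<close> and \<open>w\<close> in \<open>U\<close> have
    finely divisible traces on \<open>x\<close> and on \<open>u - x\<close>. Then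
    \<open>inf v w\<close> is a disjoint sum of two finely divisible components, although it belongs
    to \<open>U\<close>.\<close>
  have ultra: "x \<in> U \<or> u - x \<in> U" if x: "x \<in> lat_components u" for x
  proof (rule ccontr)
    assume "\<not> (x \<in> U \<or> u - x \<in> U)"
    then obtain v w where v: "v \<in> U" "finely_divisible S d (inf v x)"
      and w: "w \<in> U" "finely_divisible S d (inf w (u - x))"
      using mem[OF x] mem[OF diff_in_lat_components[OF x]] by blast
    let ?z = "inf v w"
    have zU: "?z \<in> U" by (rule Uinf[OF v(1) w(1)])
    then have zC: "?z \<in> lat_components u" using UC by blast
    note ux = diff_in_lat_components[OF x]
    have "inf ?z x \<in> lat_components (inf v x)"
      by (rule in_lat_components_mono[OF inf_in_lat_components[OF zC x]])
        (use lat_componentsD[OF x] in \<open>auto intro: le_infI1 le_infI2\<close>)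
    then have 1: "finely_divisible S d (inf ?z x)" using v(2) finely_divisible_component by blast
    have "inf ?z (u - x) \<in> lat_components (inf w (u - x))"
      by (rule in_lat_components_mono[OF inf_in_lat_components[OF zC ux]])
        (use lat_componentsD[OF ux] in \<open>auto intro: le_infI1 le_infI2\<close>)
    then have 2: "finely_divisible S d (inf ?z (u - x))"
      using w(2) finely_divisible_component by blast
    have "inf (inf ?z x) (inf ?z (u - x)) = 0"
      by (rule inf_zero_mono[OF lat_componentsD(3)[OF x]])
        (use lat_componentsD[OF zC] lat_componentsD[OF x] in auto)
    from finely_divisible.add[OF 1 2 this] have "finely_divisible S d ?z"
      using lat_components_split[OF x lat_componentsD(1,2)[OF zC]] by simp
    with Ubad zU show False by blast
  qed
  have b: "Inf U \<in> lat_components u" using UC uU by (intro Inf_in_lat_components) auto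
  have bdd: "bdd_below U"
    by (rule bdd_belowI[of _ 0]) (use UC lat_componentsD(1)[of _ u] in auto)
  \<comment> \<open>Atomlessness enters here: a nonzero infimum has a proper nonzero component
    \<open>c\<close>. If \<open>c \<in> U\<close> then \<open>Inf U \<le> c\<close>, and if
    \<open>u - c \<in> U\<close> then \<open>c\<close> is disjoint from itself.\<close>
  have "Inf U = 0"
  proof (rule ccontr)
    assume "Inf U \<noteq> 0"
    then have "0 < Inf U" using lat_componentsD(1)[OF b] by (simp add: less_le)
    then obtain c where c: "c \<in> lat_components (Inf U)" "c \<noteq> 0" "c \<noteq> Inf U"
      using not_atom_split atomless by blast
    have cu: "c \<in> lat_components u" by (rule lat_components_trans[OF c(1) b])
    from ultra[OF cu] show False
    proof
      assume "c \<in> U"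
      then have "Inf U \<le> c" using bdd by (rule cInf_lower)
      then show False using lat_componentsD(2)[OF c(1)] c(3) by simp
    next
      assume "u - c \<in> U"
      then have "Inf U \<le> u - c" using bdd by (rule cInf_lower)
      then have "c \<le> u - c" using lat_componentsD(2)[OF c(1)] by (rule order_trans[rotated])
      then have "inf c (u - c) = c" by (rule inf_absorb1)
      then show False using lat_componentsD(3)[OF cu] c(2) by simp
    qed
  qed
  then have "z \<le> 0" if "\<And>a. a \<in> U \<Longrightarrow> z \<le> a" for z
    using cInf_greatest[of U z] that uU by auto
  \<comment> \<open>Half of \<open>d\<close>, because a component \<open>w\<close> of
    \<open>y\<close> whose complement belongs to \<open>U\<close> is estimated through
    \<open>S w = S y - S (y - w)\<close>.\<close>
  with cont[OF UC _ Uinf, of "d / 2"] uU d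
  obtain y where y: "y \<in> U" "\<And>z. z \<in> U \<Longrightarrow> z \<le> y \<Longrightarrow> norm (S z) < d / 2" by fastforce
  have yC: "y \<in> lat_components u" using y(1) UC by blast
  have "norm (S w) \<le> d" if w: "w \<in> lat_components y" for w
  proof -
    have wu: "w \<in> lat_components u" by (rule lat_components_trans[OF w yC])
    have wy: "w \<le> y" "0 \<le> w" using lat_componentsD[OF w] by auto
    from ultra[OF wu] show ?thesis
    proof
      assume "w \<in> U"
      from y(2)[OF this wy(1)] d show ?thesis by simp
    next
      assume "u - w \<in> U"
      then have "inf y (u - w) \<in> U" by (rule Uinf[OF y(1)])
      moreover have "inf y (u - w) = y - w"
        using lat_components_split[OF wu lat_componentsD(1,2)[OF yC]] wy
        by (simp add: inf_absorb2 eq_diff_eq add.commute)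
      ultimately have "norm (S (y - w)) < d / 2" using y(2) wy by simp
      moreover have "norm (S y) < d / 2" using y by simp
      moreover have "S y = S w + S (y - w)" using add[OF lat_componentsD(3)[OF w]] by simp
      then have "norm (S w) \<le> norm (S y) + norm (S (y - w))"
        using norm_triangle_ineq4[of "S y" "S (y - w)"] by simp
      ultimately show ?thesis by simp
    qed
  qed
  then have "finely_divisible S d y"
    using lat_componentsD(1)[OF yC] by (rule finely_divisible.small[rotated])
  with Ubad y(1) show False by blast
qed

text \<open>The signs are chosen greedily, so that the mixed term in each square of a sum is not positive.
  The right-hand side is \<open>d\<close> times a quantity that is additive in \<open>x\<close>.\<close>

lemma finely_divisible_balance:
  fixes S :: "'a::vector_lattice \<Rightarrow> 'b::real_normed_vector" and J :: "('b \<Rightarrow> real) set"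
  assumes "finely_divisible S d x"
    and add: "\<And>x y. inf x y = 0 \<Longrightarrow> S (x + y) = S x + S y"
    and lin: "\<And>f. f \<in> J \<Longrightarrow> linear f" and norm: "\<And>f v. f \<in> J \<Longrightarrow> \<bar>f v\<bar> \<le> norm v"
  shows "\<exists>a\<in>lat_components x. \<exists>w. (\<forall>f\<in>J. w f \<in> lat_components x) \<and>
    (\<Sum>f\<in>J. (f (S a - S (x - a)))\<^sup>2) \<le> d * (\<Sum>f\<in>J. f (S (w f) - S (x - w f)))"
  using assms(1)
proof induction
  case (small x)
  have S0: "S 0 = 0" using add[of 0 0] by simp
  \<comment> \<open>The sign of \<open>f (S x)\<close> selects \<open>x\<close> or \<open>0\<close>,
    so that \<open>f\<close> of the difference becomes \<open>\<bar>f (S x)\<bar>\<close>. As this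
    is at most \<open>d\<close>, its square is at most \<open>d\<close> times it.\<close>
  define w where "w = (\<lambda>f::'b \<Rightarrow> real. if 0 \<le> f (S x) then x else 0)"
  have "(f (S x - S (x - x)))\<^sup>2 \<le> d * f (S (w f) - S (x - w f))" if f: "f \<in> J" for f
  proof -
    have "f (S (w f) - S (x - w f)) = \<bar>f (S x)\<bar>"
      using linear_neg[OF lin[OF f]] by (auto simp: w_def S0)
    moreover have "\<bar>f (S x)\<bar> \<le> d"
      using norm[OF f, of "S x"] small(2)[OF self_in_lat_components[OF small(1)]] by simp
    then have "\<bar>f (S x)\<bar> * \<bar>f (S x)\<bar> \<le> d * \<bar>f (S x)\<bar>" by (intro mult_right_mono) auto
    ultimately show ?thesis by (simp add: S0 power2_eq_square)
  qed
  then have "(\<Sum>f\<in>J. (f (S x - S (x - x)))\<^sup>2) \<le> d * (\<Sum>f\<in>J. f (S (w f) - S (x - w f)))"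
    unfolding sum_distrib_left by (rule sum_mono)
  moreover have "w f \<in> lat_components x" for f
    using small(1) by (simp add: w_def self_in_lat_components zero_in_lat_components)
  ultimately show ?case using self_in_lat_components[OF small(1)] by blast
next
  case (add x y)
  define D where "D = (\<lambda>x a. S a - S (x - a))"
  obtain a w where a: "a \<in> lat_components x" "\<And>f. f \<in> J \<Longrightarrow> w f \<in> lat_components x"
      "(\<Sum>f\<in>J. (f (D x a))\<^sup>2) \<le> d * (\<Sum>f\<in>J. f (D x (w f)))"
    using add.IH(1) unfolding D_def by blast
  obtain b v where b: "b \<in> lat_components y" "\<And>f. f \<in> J \<Longrightarrow> v f \<in> lat_components y"
      "(\<Sum>f\<in>J. (f (D y b))\<^sup>2) \<le> d * (\<Sum>f\<in>J. f (D y (v f)))"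
    using add.IH(2) unfolding D_def by blast
  have Dadd: "D (x + y) (a + b) = D x a + D y b"
    if a: "a \<in> lat_components x" and b: "b \<in> lat_components y" for a b
  proof -
    note c = lat_componentsD[OF a] lat_componentsD[OF b]
    have "inf a b = 0" by (rule inf_zero_mono[OF add.hyps(3)]) (use c in auto)
    moreover have "inf (x - a) (y - b) = 0"
      by (rule inf_zero_mono[OF add.hyps(3)]) (use c in auto)
    ultimately show ?thesis
      unfolding D_def add_diff_add by (simp only: assms(2)) (simp add: algebra_simps)
  qed
  have Dneg: "D y (y - b) = - D y b" by (simp add: D_def)
  have sq: "(\<Sum>f\<in>J. (f (p + q))\<^sup>2) =
      (\<Sum>f\<in>J. (f p)\<^sup>2) + (\<Sum>f\<in>J. (f q)\<^sup>2) + 2 * (\<Sum>f\<in>J. f p * f q)" for p q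
  proof -
    have "(\<Sum>f\<in>J. (f (p + q))\<^sup>2) = (\<Sum>f\<in>J. (f p)\<^sup>2 + (f q)\<^sup>2 + 2 * (f p * f q))"
      by (rule sum.cong) (auto simp: linear_add[OF lin] power2_sum)
    then show ?thesis by (simp add: sum.distrib sum_distrib_left)
  qed
  \<comment> \<open>Passing from \<open>b\<close> to \<open>y - b\<close> negates
    \<open>D y b\<close> and keeps all squares. The mixed terms are summed over \<open>J\<close>, so
    one choice of sign serves all functionals at once.\<close>
  have "\<exists>b'\<in>lat_components y. (\<Sum>f\<in>J. (f (D x a + D y b'))\<^sup>2) \<le>
      (\<Sum>f\<in>J. (f (D x a))\<^sup>2) + (\<Sum>f\<in>J. (f (D y b))\<^sup>2)"
  proof (cases "(\<Sum>f\<in>J. f (D x a) * f (D y b)) \<le> 0")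
    case True
    then show ?thesis using b(1) sq[of "D x a" "D y b"] by (intro bexI[of _ b]) auto
  next
    case False
    have "(\<Sum>f\<in>J. f (D x a) * f (D y (y - b))) = - (\<Sum>f\<in>J. f (D x a) * f (D y b))"
      "(\<Sum>f\<in>J. (f (D y (y - b)))\<^sup>2) = (\<Sum>f\<in>J. (f (D y b))\<^sup>2)"
      unfolding Dneg sum_negf[symmetric] by (auto intro!: sum.cong simp: linear_neg[OF lin])
    with False show ?thesis
      using diff_in_lat_components[OF b(1)] sq[of "D x a" "D y (y - b)"]
      by (intro bexI[of _ "y - b"]) auto
  qed
  then obtain b' where b': "b' \<in> lat_components y"
    "(\<Sum>f\<in>J. (f (D (x + y) (a + b')))\<^sup>2) \<le> (\<Sum>f\<in>J. (f (D x a))\<^sup>2) + (\<Sum>f\<in>J. (f (D y b))\<^sup>2)"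
    using Dadd[OF a(1)] by auto
  have "(\<Sum>f\<in>J. f (D (x + y) (w f + v f))) = (\<Sum>f\<in>J. f (D x (w f))) + (\<Sum>f\<in>J. f (D y (v f)))"
    unfolding sum.distrib[symmetric] using Dadd a(2) b(2)
    by (intro sum.cong) (auto simp: linear_add[OF lin])
  with b'(2) a(3) b(3)
  have "(\<Sum>f\<in>J. (f (D (x + y) (a + b')))\<^sup>2) \<le> d * (\<Sum>f\<in>J. f (D (x + y) (w f + v f)))"
    by (simp add: distrib_left)
  moreover have "a + b' \<in> lat_components (x + y)"
    using add_in_lat_components[OF a(1) b'(1) add.hyps(3)] .
  moreover have "\<forall>f\<in>J. w f + v f \<in> lat_components (x + y)"
    using add_in_lat_components[OF a(2) b(2) add.hyps(3)] by blast
  ultimately show ?case unfolding D_def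
    by (intro bexI[of _ "a + b'"] exI[of _ "\<lambda>f. w f + v f"] conjI)
qed

section \<open>Norming functionals\<close>

definition sublinear :: "('a::real_vector \<Rightarrow> real) \<Rightarrow> bool" where
  "sublinear p \<longleftrightarrow> (\<forall>x y. p (x + y) \<le> p x + p y) \<and> (\<forall>c x. 0 \<le> c \<longrightarrow> p (c *\<^sub>R x) = c * p x)"

lemma sublinearD:
  assumes "sublinear p"
  shows "p (x + y) \<le> p x + p y" "0 \<le> c \<Longrightarrow> p (c *\<^sub>R x) = c * p x" "- p (- x) \<le> p x" "p 0 = 0"
proof -
  show 1: "\<And>x y. p (x + y) \<le> p x + p y" "\<And>c x. 0 \<le> c \<Longrightarrow> p (c *\<^sub>R x) = c * p x"
    using assms by (auto simp: sublinear_def)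
  from 1(2)[of 0 0] show "p 0 = 0" by simp
  with 1(1)[of x "- x"] show "- p (- x) \<le> p x" by simp
qed

text \<open>Used for chains of sublinear functionals and for the family behind \<open>tilt\<close>,
  whose members need not be sublinear; therefore the witnesses may depend on the points. Equality in
  homogeneity comes from applying the inequality with \<open>1 / c\<close>.\<close>

lemma sublinear_Inf:
  fixes P :: "('a::real_vector \<Rightarrow> real) set"
  assumes ne: "P \<noteq> {}"
    and pos: "\<And>p c x. p \<in> P \<Longrightarrow> 0 < c \<Longrightarrow> \<exists>q\<in>P. q (c *\<^sub>R x) \<le> c * p x"
    and sub: "\<And>p q x y. p \<in> P \<Longrightarrow> q \<in> P \<Longrightarrow> \<exists>r\<in>P. r (x + y) \<le> p x + q y"
    and bdd: "\<And>x. bdd_below ((\<lambda>p. p x) ` P)"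
    and zero: "\<And>p. p \<in> P \<Longrightarrow> p 0 = 0"
  shows "sublinear (\<lambda>x. INF p\<in>P. p x)"
proof -
  let ?g = "\<lambda>x. INF p\<in>P. p x"
  have low: "?g x \<le> p x" if "p \<in> P" for p x by (rule cINF_lower[OF bdd that])
  have great: "z \<le> ?g x" if "\<And>p. p \<in> P \<Longrightarrow> z \<le> p x" for z x
    by (rule cINF_greatest[OF ne]) (use that in auto)
  have add: "?g (x + y) \<le> ?g x + ?g y" for x y
  proof -
    have "?g (x + y) - q y \<le> ?g x" if "q \<in> P" for q
    proof (rule great)
      fix p assume "p \<in> P"
      with sub that obtain r where "r \<in> P" "r (x + y) \<le> p x + q y" by blast
      with low[of r "x + y"] show "?g (x + y) - q y \<le> p x" by simp
    qed
    then have "?g (x + y) - ?g x \<le> q y" if "q \<in> P" for q using that by (simp add: algebra_simps)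
    then have "?g (x + y) - ?g x \<le> ?g y" by (rule great)
    then show ?thesis by simp
  qed
  have le: "?g (c *\<^sub>R x) \<le> c * ?g x" if c: "0 < c" for c x
  proof -
    have "?g (c *\<^sub>R x) / c \<le> ?g x"
    proof (rule great)
      fix p assume "p \<in> P"
      with pos c obtain q where "q \<in> P" "q (c *\<^sub>R x) \<le> c * p x" by blast
      with low[of q "c *\<^sub>R x"] show "?g (c *\<^sub>R x) / c \<le> p x"
        using c by (simp add: divide_le_eq mult.commute)
    qed
    then show ?thesis using c by (simp add: divide_le_eq mult.commute)
  qed
  have "?g (c *\<^sub>R x) = c * ?g x" if c: "0 \<le> c" for c x
  proof (cases "c = 0")
    case True
    have "?g 0 = (INF p\<in>P. 0)" using zero by (intro INF_cong) auto
    then show ?thesis using True ne by simp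
  next
    case False
    then have c: "0 < c" using that by simp
    have "?g x \<le> ?g (c *\<^sub>R x) / c" using le[of "1 / c" "c *\<^sub>R x"] c by simp
    then have "c * ?g x \<le> ?g (c *\<^sub>R x)" using c by (simp add: le_divide_eq mult.commute)
    with le[OF c] show ?thesis by (rule order.antisym)
  qed
  with add show ?thesis unfolding sublinear_def by blast
qed

text \<open>For sublinear \<open>p\<close> this lowers \<open>p\<close> in the direction
  \<open>- v\<close>: \<open>t = 0\<close> shows that the result is at most \<open>p\<close>, and
  \<open>t = 1\<close> that its value at \<open>- v\<close> is at most \<open>- p v\<close>.\<close>

definition tilt :: "('a::real_vector \<Rightarrow> real) \<Rightarrow> 'a \<Rightarrow> 'a \<Rightarrow> real" where
  "tilt p v x = (INF t\<in>{0..}. p (x + t *\<^sub>R v) - t * p v)"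

lemma tilt_bdd_below:
  assumes p: "sublinear p"
  shows "bdd_below ((\<lambda>t. p (x + t *\<^sub>R v) - t * p v) ` {0..})"
proof (rule bdd_belowI2)
  fix t :: real assume "t \<in> {0..}"
  then have "p (t *\<^sub>R v) = t * p v" using sublinearD(2)[OF p] by simp
  moreover have "p (t *\<^sub>R v) \<le> p (x + t *\<^sub>R v) + p (- x)"
    using sublinearD(1)[OF p, of "x + t *\<^sub>R v" "- x"] by simp
  ultimately show "- p (- x) \<le> p (x + t *\<^sub>R v) - t * p v" by simp
qed

lemma tilt_le:
  assumes p: "sublinear p" and "0 \<le> t"
  shows "tilt p v x \<le> p (x + t *\<^sub>R v) - t * p v"
  unfolding tilt_def by (rule cINF_lower[OF tilt_bdd_below[OF p]]) (use assms in simp)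

text \<open>Scaling the point by \<open>c\<close> is matched by the parameter \<open>c * t\<close>,
  and adding two points by \<open>t + s\<close>.\<close>

lemma sublinear_tilt:
  assumes p: "sublinear p"
  shows "sublinear (tilt p v)"
proof -
  define h where "h = (\<lambda>t x. p (x + t *\<^sub>R v) - t * p v)"
  have "sublinear (\<lambda>x. INF q\<in>h ` {0..}. q x)"
  proof (rule sublinear_Inf)
    fix q c x assume "q \<in> h ` {0..}" and c: "(0::real) < c"
    then obtain t where t: "0 \<le> t" "q = h t" by auto
    have "p (c *\<^sub>R x + (c * t) *\<^sub>R v) = c * p (x + t *\<^sub>R v)"
      using sublinearD(2)[OF p, of c "x + t *\<^sub>R v"] c by (simp add: scaleR_add_right)
    then have "h (c * t) (c *\<^sub>R x) \<le> c * q x"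
      by (simp add: t h_def right_diff_distrib)
    moreover have "h (c * t) \<in> h ` {0..}" using t c by simp
    ultimately show "\<exists>r\<in>h ` {0..}. r (c *\<^sub>R x) \<le> c * q x" by blast
  next
    fix q r x y assume "q \<in> h ` {0..}" "r \<in> h ` {0..}"
    then obtain t s where t: "0 \<le> t" "q = h t" and s: "0 \<le> s" "r = h s" by auto
    have "p ((x + y) + (t + s) *\<^sub>R v) \<le> p (x + t *\<^sub>R v) + p (y + s *\<^sub>R v)"
      using sublinearD(1)[OF p, of "x + t *\<^sub>R v" "y + s *\<^sub>R v"] by (simp add: algebra_simps)
    then have "h (t + s) (x + y) \<le> q x + r y"
      by (simp add: t s h_def distrib_right)
    moreover have "h (t + s) \<in> h ` {0..}" using t s by simp
    ultimately show "\<exists>w\<in>h ` {0..}. w (x + y) \<le> q x + r y" by blast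
  next
    show "bdd_below ((\<lambda>q. q x) ` h ` {0..})" for x
      using tilt_bdd_below[OF p, of x v] by (simp add: image_image h_def)
    show "q 0 = 0" if "q \<in> h ` {0..}" for q
      using that sublinearD(2,4)[OF p] by (auto simp: h_def)
  qed auto
  then show ?thesis by (simp add: tilt_def[abs_def] image_image h_def)
qed

text \<open>Minimality gives \<open>tilt p v = p\<close>. The parameter \<open>t = 1\<close> then
  yields \<open>p x + p v \<le> p (x + v)\<close>, the reverse of subadditivity.\<close>

lemma minimal_sublinear_linear:
  assumes p: "sublinear p" and min: "\<And>q. sublinear q \<Longrightarrow> q \<le> p \<Longrightarrow> q = p"
  shows "linear p"
proof -
  have t: "tilt p v = p" for v
  proof (rule min[OF sublinear_tilt[OF p]])
    show "tilt p v \<le> p" using tilt_le[OF p, of 0 v] by (simp add: le_fun_def)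
  qed
  have add: "p (x + v) = p x + p v" for x v
    using tilt_le[OF p, of 1 v x] sublinearD(1)[OF p, of x v] by (simp add: t)
  from add[of x "- x" for x] have neg: "p (- x) = - p x" for x
    using sublinearD(4)[OF p] by (simp add: eq_neg_iff_add_eq_0 add.commute)
  show ?thesis
  proof (rule linearI)
    fix c x show "p (c *\<^sub>R x) = c *\<^sub>R p x"
      using sublinearD(2)[OF p, of c x] sublinearD(2)[OF p, of "- c" x] neg[of "c *\<^sub>R x"]
      by (cases "0 \<le> c") auto
  qed (rule add)
qed

text \<open>Everything sublinear below \<open>p\<close> is at least \<open>- p (- x)\<close> at
  \<open>x\<close>, so a nonempty chain has a pointwise infimum, which is again sublinear.\<close>

lemma exists_minimal_sublinear:
  assumes p: "sublinear p"
  obtains f where "sublinear f" "f \<le> p" "\<And>q. sublinear q \<Longrightarrow> q \<le> f \<Longrightarrow> q = f"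
proof -
  define A where "A = {q. sublinear q \<and> q \<le> p}"
  have "\<exists>m\<in>A. \<forall>a\<in>A. a \<le> m \<longrightarrow> a = m"
  \<comment> \<open>The order is reversed, so that a maximal element in Zorn's sense is a minimal
    functional.\<close>
  proof (rule predicate_Zorn)
    show "partial_order_on A (relation_of (\<lambda>x y. y \<le> x) A)"
      by (rule partial_order_on_relation_ofI) auto
  next
    fix C assume C: "C \<in> Chains (relation_of (\<lambda>x y. y \<le> x) A)"
    then have CA: "C \<subseteq> A" and tot: "\<And>q r. q \<in> C \<Longrightarrow> r \<in> C \<Longrightarrow> q \<le> r \<or> r \<le> q"
      by (auto simp: Chains_def relation_of_def)
    show "\<exists>m\<in>A. \<forall>a\<in>C. m \<le> a"
    proof (cases "C = {}")
      case True
      then show ?thesis using p by (auto simp: A_def)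
    next
      case False
      define g where "g = (\<lambda>x. INF q\<in>C. q x)"
      have bdd: "bdd_below ((\<lambda>q. q x) ` C)" for x
      proof (rule bdd_belowI2)
        fix q assume "q \<in> C"
        then have "sublinear q" "q (- x) \<le> p (- x)" using CA by (auto simp: A_def le_fun_def)
        then show "- p (- x) \<le> q x" using sublinearD(3)[of q x] by simp
      qed
      have g: "g \<le> q" if "q \<in> C" for q
        unfolding g_def le_fun_def using cINF_lower[OF bdd that] by blast
      have "sublinear g" unfolding g_def
      proof (rule sublinear_Inf[OF False _ _ bdd])
        fix q c x assume "q \<in> C" "(0::real) < c"
        then show "\<exists>r\<in>C. r (c *\<^sub>R x) \<le> c * q x"
          using CA sublinearD(2)[of q c x] by (intro bexI[of _ q]) (auto simp: A_def)
      next
        fix q r x y assume qr: "q \<in> C" "r \<in> C"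
        then have s: "sublinear q" "sublinear r" using CA by (auto simp: A_def)
        from tot[OF qr] show "\<exists>w\<in>C. w (x + y) \<le> q x + r y"
        proof
          assume "q \<le> r"
          then have "q (x + y) \<le> q x + r y"
            using sublinearD(1)[OF s(1), of x y] le_funD[of q r y] by linarith
          then show ?thesis using qr by blast
        next
          assume "r \<le> q"
          then have "r (x + y) \<le> q x + r y"
            using sublinearD(1)[OF s(2), of x y] le_funD[of r q x] by linarith
          then show ?thesis using qr by blast
        qed
      qed (use CA sublinearD(4) in \<open>auto simp: A_def\<close>)
      moreover have "g \<le> p"
        using False g CA by (auto simp: A_def intro: order_trans)
      ultimately show ?thesis using g by (auto simp: A_def)
    qed
  qed
  then obtain f where "f \<in> A" "\<forall>a\<in>A. a \<le> f \<longrightarrow> a = f" by blast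
  then show ?thesis using that[of f] by (auto simp: A_def intro: order_trans)
qed

text \<open>A linear minorant of the norm tilted along \<open>v\<close> must take the value \<open>- norm v\<close> at \<open>- v\<close>.\<close>

lemma Hahn_Banach_norming:
  fixes v :: "'a::real_normed_vector"
  obtains f :: "'a \<Rightarrow> real" where "linear f" "\<And>x. \<bar>f x\<bar> \<le> norm x" "f v = norm v"
proof -
  have norm: "sublinear (norm :: 'a \<Rightarrow> real)"
    by (simp add: sublinear_def norm_triangle_ineq)
  obtain f where f: "sublinear f" "f \<le> tilt norm v" "\<And>q. sublinear q \<Longrightarrow> q \<le> f \<Longrightarrow> q = f"
    using exists_minimal_sublinear[OF sublinear_tilt[OF norm, of v]] by blast
  have lin: "linear f" by (rule minimal_sublinear_linear[OF f(1,3)])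
  have fp: "f x \<le> tilt norm v x" for x using f(2) by (rule le_funD)
  have le: "f x \<le> norm x" for x
    using fp[of x] tilt_le[OF norm, of 0 v x] by simp
  have "\<bar>f x\<bar> \<le> norm x" for x
    using le[of x] le[of "- x"] linear_neg[OF lin, of x] by simp
  moreover have "f (- v) \<le> - norm v"
    using fp[of "- v"] tilt_le[OF norm, of 1 v "- v"] by simp
  then have "f v = norm v" using le[of v] linear_neg[OF lin, of v] by simp
  ultimately show ?thesis using lin that by blast
qed

text \<open>Take norming functionals at the centres of a finite \<open>\<epsilon> / 2\<close>-net.
  Moving from \<open>v\<close> to a nearby centre costs the distance twice, once in the norm and
  once in the functional.\<close>

lemma finite_norming_functionals:
  fixes K :: "'a::real_normed_vector set"
  assumes "compact K" "0 < \<epsilon>"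
  obtains J :: "('a \<Rightarrow> real) set" where "finite J" "\<And>f. f \<in> J \<Longrightarrow> linear f"
    "\<And>f v. f \<in> J \<Longrightarrow> \<bar>f v\<bar> \<le> norm v" "\<And>v. v \<in> K \<Longrightarrow> \<exists>f\<in>J. norm v \<le> \<bar>f v\<bar> + \<epsilon>"
proof -
  obtain N where N: "finite N" "K \<subseteq> (\<Union>x\<in>N. ball x (\<epsilon> / 2))"
    using assms compact_eq_totally_bounded[of K] by (meson half_gt_zero)
  have "\<exists>f. linear f \<and> (\<forall>v. \<bar>f v\<bar> \<le> norm v) \<and> f x = norm x" for x :: 'a
    using Hahn_Banach_norming[of x] by metis
  then obtain F :: "'a \<Rightarrow> 'a \<Rightarrow> real" where F: "\<And>x. linear (F x)"
    "\<And>x v. \<bar>F x v\<bar> \<le> norm v" "\<And>x. F x x = norm x" by metis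
  show ?thesis
  proof (rule that[of "F ` N"])
    fix v assume "v \<in> K"
    then obtain x where x: "x \<in> N" "norm (x - v) < \<epsilon> / 2"
      using N(2) by (auto simp: dist_norm)
    have "norm v \<le> norm x + norm (x - v)"
      using norm_triangle_ineq4[of x "x - v"] by simp
    also have "norm x = F x v + F x (x - v)" using F(3)[of x] linear_diff[OF F(1)] by simp
    also have "\<dots> \<le> \<bar>F x v\<bar> + norm (x - v)"
      using F(2)[of x "x - v"] by (intro add_mono) auto
    finally have "norm v \<le> \<bar>F x v\<bar> + \<epsilon>" using x(2) by simp
    then show "\<exists>f\<in>F ` N. norm v \<le> \<bar>f v\<bar> + \<epsilon>" using x(1) by blast
  qed (use N F in auto)
qed

section \<open>From fragments to components\<close>

text \<open>The map sending a component of \<open>\<bar>e\<bar>\<close> to the corresponding fragment of \<open>e\<close>.\<close>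

definition fragment_part :: "'a::vector_lattice \<Rightarrow> 'a \<Rightarrow> 'a" where
  "fragment_part e a = inf a (pprt e) - inf a (- nprt e)"

text \<open>\<open>\<bar>e\<bar>\<close> is the sum of the two parts, hence their supremum plus
  their infimum, yet it is at most their supremum.\<close>

lemma inf_pprt_nprt:
  fixes e :: "'a::vector_lattice"
  shows "inf (pprt e) (- nprt e) = 0"
proof (rule order.antisym)
  have "e \<le> pprt e" "- e \<le> - nprt e" by (simp_all add: pprt_def nprt_def)
  then have "\<bar>e\<bar> \<le> sup (pprt e) (- nprt e)"
    unfolding abs_lattice by (rule sup_mono)
  moreover have "\<bar>e\<bar> = sup (pprt e) (- nprt e) + inf (pprt e) (- nprt e)"
    using add_eq_inf_sup[of "pprt e" "- nprt e"] by (simp only: abs_prts) simp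
  ultimately show "inf (pprt e) (- nprt e) \<le> 0" by (simp only: add_le_same_cancel1)
qed simp

lemma fragment_part_add:
  "inf a b = 0 \<Longrightarrow> fragment_part e (a + b) = fragment_part e a + fragment_part e b"
  using inf_add_disjoint[of a b "pprt e"] inf_add_disjoint[of a b "- nprt e"]
  by (simp add: fragment_part_def inf_commute)

lemma abs_fragment_part_le:
  fixes a :: "'a::vector_lattice"
  assumes "0 \<le> a"
  shows "\<bar>fragment_part e a\<bar> \<le> a"
proof -
  have "\<bar>fragment_part e a\<bar> \<le> inf a (pprt e) + inf a (- nprt e)"
    unfolding fragment_part_def
    using abs_triangle_ineq4[of "inf a (pprt e)" "inf a (- nprt e)"] assms by simp
  also have "\<dots> \<le> a"
    by (rule add_le_of_disjoint, rule inf_zero_mono[OF inf_pprt_nprt[of e]]) (use assms in auto)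
  finally show ?thesis .
qed

lemma lat_disjoint_fragment_part:
  assumes "inf a b = 0"
  shows "lat_disjoint (fragment_part e a) (fragment_part e b)"
  unfolding lat_disjoint_def
  by (rule inf_zero_mono[OF assms]) (simp_all add: abs_fragment_part_le inf_zeroD[OF assms])

lemma fragment_part_abs:
  fixes e :: "'a::vector_lattice"
  shows "fragment_part e \<bar>e\<bar> = e"
proof -
  have "pprt e \<le> \<bar>e\<bar>" "- nprt e \<le> \<bar>e\<bar>" by (simp_all add: abs_prts)
  then have "fragment_part e \<bar>e\<bar> = pprt e - - nprt e"
    unfolding fragment_part_def by (simp only: inf_absorb2)
  then show ?thesis using prts[of e] by simp
qed

lemma mc_fragments_fragment_part:
  assumes "a \<in> lat_components \<bar>e\<bar>"
  shows "mc_fragments e (fragment_part e a) (fragment_part e (\<bar>e\<bar> - a))"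
  using fragment_part_add[OF lat_componentsD(3)[OF assms], of e] fragment_part_abs[of e]
    lat_disjoint_fragment_part[OF lat_componentsD(3)[OF assms], of e]
  by (simp add: mc_fragments_def)

lemma fragment_of_fragment_part:
  assumes a: "a \<in> lat_components u" and b: "b \<in> lat_components u" and "a \<le> b"
  shows "fragment_of (fragment_part e a) (fragment_part e b)"
proof -
  have "a \<in> lat_components b"
    using a assms(3) lat_componentsD(2)[OF b] by (rule in_lat_components_mono)
  note d = lat_componentsD(3)[OF this]
  show ?thesis
    using fragment_part_add[OF d, of e] lat_disjoint_fragment_part[OF d, of e]
    by (simp add: fragment_of_def)
qed

text \<open>Lateral nets grow while \<open>U\<close> shrinks, so the complements are used: the
  fragments belonging to \<open>\<bar>e\<bar> - a\<close> converge laterally to \<open>e\<close>,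
  with error at most the index \<open>a\<close> itself. By additivity \<open>T\<close> of the part
  at \<open>a\<close> is what \<open>T e\<close> still lacks.\<close>

lemma laterally_to_norm_continuous_fragment_part:
  fixes T :: "'a::vector_lattice \<Rightarrow> 'b::real_normed_vector"
  assumes oa: "orthogonally_additive T" and cont: "laterally_to_norm_continuous T"
    and U: "U \<subseteq> lat_components \<bar>e\<bar>" "U \<noteq> {}" "\<And>a b. a \<in> U \<Longrightarrow> b \<in> U \<Longrightarrow> inf a b \<in> U"
    and U0: "\<And>z. (\<And>a. a \<in> U \<Longrightarrow> z \<le> a) \<Longrightarrow> z \<le> 0" and "0 < \<epsilon>"
  shows "\<exists>a\<in>U. \<forall>b\<in>U. b \<le> a \<longrightarrow> norm (T (fragment_part e b)) < \<epsilon>"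
proof -
  let ?u = "\<bar>e\<bar>" and ?\<phi> = "fragment_part e" and ?le = "\<lambda>a b :: 'a. b \<le> a"
  have UC: "a \<in> lat_components ?u" if "a \<in> U" for a using U(1) that by blast
  have split: "e = ?\<phi> a + ?\<phi> (?u - a)" "lat_disjoint (?\<phi> a) (?\<phi> (?u - a))" if "a \<in> U" for a
    using mc_fragments_fragment_part[OF UC[OF that]] by (simp_all add: mc_fragments_def)
  have dir: "directed_index U ?le"
    unfolding directed_index_def using U(2,3) by (auto intro: order_trans inf_le1 inf_le2)
  have frag: "fragment_of (?\<phi> (?u - a)) (?\<phi> (?u - b))" if "a \<in> U" "b \<in> U" "b \<le> a" for a b
    using that by (intro fragment_of_fragment_part[of _ ?u] diff_in_lat_components UC) auto
  have frag_e: "fragment_of (?\<phi> (?u - b)) e" if "b \<in> U" for b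
  proof -
    have "e - ?\<phi> (?u - b) = ?\<phi> b" using split(1)[OF that] by (metis add_diff_cancel_right')
    then show ?thesis using lat_disjoint_sym[OF split(2)[OF that]] by (simp only: fragment_of_def)
  qed
  have "net_decreases_to_0 U ?le (\<lambda>a. a)"
    unfolding net_decreases_to_0_def using UC lat_componentsD(1) U0 by blast
  moreover have "\<bar>?\<phi> (?u - a) - e\<bar> \<le> a" if "a \<in> U" for a
  proof -
    have "?\<phi> (?u - a) - e = - ?\<phi> a" using split(1)[OF that] by (simp add: algebra_simps)
    then show ?thesis using abs_fragment_part_le[OF lat_componentsD(1)[OF UC[OF that]]] by simp
  qed
  ultimately have "order_converges U ?le (\<lambda>a. ?\<phi> (?u - a)) e"
    unfolding order_converges_def by blast
  then have "laterally_converges U ?le (\<lambda>a. ?\<phi> (?u - a)) e"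
    unfolding laterally_converges_def strict_index_def using frag frag_e by blast
  then have "((\<lambda>a. norm (T (?\<phi> (?u - a)) - T e)) \<longlongrightarrow> 0) (net_filter U ?le)"
    using laterally_to_norm_continuousD[OF cont dir] by blast
  then have "eventually (\<lambda>a. norm (T (?\<phi> (?u - a)) - T e) < \<epsilon>) (net_filter U ?le)"
    using \<open>0 < \<epsilon>\<close> by (rule order_tendstoD(2))
  moreover have "norm (T (?\<phi> (?u - a)) - T e) = norm (T (?\<phi> a))" if "a \<in> U" for a
  proof -
    have "T (?\<phi> a + ?\<phi> (?u - a)) = T (?\<phi> a) + T (?\<phi> (?u - a))"
      using oa split(2)[OF that] by (simp add: orthogonally_additive_def)
    then have "T e = T (?\<phi> a) + T (?\<phi> (?u - a))" using split(1)[OF that] by simp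
    then show ?thesis by simp
  qed
  ultimately show ?thesis unfolding eventually_net_filter[OF dir] by auto
qed

section \<open>Choice of constants and the final estimate\<close>

theorem theorem3p2:
  fixes T :: "'e::dedekind_complete_vector_lattice \<Rightarrow> 'f::banach"
  assumes atomless: "\<not> (\<exists>u::'e. is_atom u)"
    and "orthogonally_additive T"
    and "laterally_to_norm_continuous T"
    and "C_compact T"
  shows "narrow T"
  unfolding narrow_def
proof (intro allI impI)
  fix e :: 'e and \<epsilon> :: real assume \<epsilon>: "0 < \<epsilon>"
  let ?u = "\<bar>e\<bar>"
  define S where "S = (\<lambda>a. T (fragment_part e a))"
  define D where "D = (\<lambda>a. S a - S (?u - a))"
  have add: "S (x + y) = S x + S y" if "inf x y = 0" for x y
    using assms(2) lat_disjoint_fragment_part[OF that] fragment_part_add[OF that]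
    by (simp add: S_def orthogonally_additive_def)
  define K where "K = closure {T y |y. fragment_of y e}"
  have K: "compact K" using assms(4) by (simp add: C_compact_def K_def)
  have SK: "S a \<in> K" if "a \<in> lat_components ?u" for a
  proof -
    have "fragment_of (fragment_part e a) (fragment_part e ?u)"
      using that by (intro fragment_of_fragment_part[of _ ?u])
        (auto simp: self_in_lat_components lat_componentsD)
    then show ?thesis
      unfolding K_def S_def fragment_part_abs by (intro closure_subset[THEN subsetD]) blast
  qed
  \<comment> \<open>The functionals have to norm the differences \<open>D a\<close>, and these all
    lie in the compact set \<open>KK\<close>.\<close>
  define KK where "KK = {x - y |x y. x \<in> K \<and> y \<in> K}"
  have KK: "compact KK" unfolding KK_def by (rule compact_differences[OF K K])
  have DK: "D a \<in> KK" if "a \<in> lat_components ?u" for a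
    using SK[OF that] SK[OF diff_in_lat_components[OF that]] by (auto simp: D_def KK_def)
  have "0 < \<epsilon> / 2" using \<epsilon> by simp
  from finite_norming_functionals[OF KK this]
  obtain J where J: "finite J" "\<And>f. f \<in> J \<Longrightarrow> linear f"
    "\<And>f v. f \<in> J \<Longrightarrow> \<bar>f v\<bar> \<le> norm v" "\<And>v. v \<in> KK \<Longrightarrow> \<exists>f\<in>J. norm v \<le> \<bar>f v\<bar> + \<epsilon> / 2"
    by blast
  obtain M where M: "0 < M" "\<And>v. v \<in> KK \<Longrightarrow> norm v \<le> M"
    using compact_imp_bounded[OF KK] unfolding bounded_pos by blast
  \<comment> \<open>Chosen so that \<open>d * (card J * M)\<close> falls below
    \<open>(\<epsilon> / 2)\<^sup>2\<close>; the \<open>+ 1\<close> makes this strict and keeps the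
    denominator positive.\<close>
  define d where "d = (\<epsilon> / 2)\<^sup>2 / (real (card J + 1) * M)"
  have d: "0 < d" using \<epsilon> M(1) by (simp add: d_def)
  have fd: "finely_divisible S d ?u"
  proof (rule finely_divisible_of_order_continuous[OF atomless abs_ge_zero d add])
    show "\<exists>a\<in>U. \<forall>b\<in>U. b \<le> a \<longrightarrow> norm (S b) < \<delta>"
      if "U \<subseteq> lat_components ?u" "U \<noteq> {}" "\<And>a b. a \<in> U \<Longrightarrow> b \<in> U \<Longrightarrow> inf a b \<in> U"
        "\<And>z. (\<And>a. a \<in> U \<Longrightarrow> z \<le> a) \<Longrightarrow> z \<le> 0" "0 < \<delta>" for U \<delta>
      unfolding S_def
      by (rule laterally_to_norm_continuous_fragment_part[OF assms(2,3) that])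
  qed
  have "\<exists>a\<in>lat_components ?u. \<exists>w. (\<forall>f\<in>J. w f \<in> lat_components ?u) \<and>
    (\<Sum>f\<in>J. (f (D a))\<^sup>2) \<le> d * (\<Sum>f\<in>J. f (D (w f)))"
    unfolding D_def by (rule finely_divisible_balance[OF fd]) (simp_all add: add J)
  then obtain a w where a: "a \<in> lat_components ?u" "\<And>f. f \<in> J \<Longrightarrow> w f \<in> lat_components ?u"
    "(\<Sum>f\<in>J. (f (D a))\<^sup>2) \<le> d * (\<Sum>f\<in>J. f (D (w f)))"
    by blast
  \<comment> \<open>Although \<open>w f\<close> varies with \<open>f\<close>, each
    \<open>D (w f)\<close> lies in \<open>KK\<close>. The bound is therefore independent of the
    number of pieces, and so of \<open>d\<close>.\<close>
  have "f (D (w f)) \<le> M" if "f \<in> J" for f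
    using J(3)[OF that, of "D (w f)"] M(2)[OF DK[OF a(2)[OF that]]] by simp
  then have "(\<Sum>f\<in>J. f (D (w f))) \<le> card J * M" by (rule sum_bounded_above)
  also have "\<dots> < real (card J + 1) * M" using M(1) by (simp add: distrib_right)
  finally have "d * (\<Sum>f\<in>J. f (D (w f))) < d * (real (card J + 1) * M)" using d by simp
  also have "\<dots> = (\<epsilon> / 2)\<^sup>2" using M(1) unfolding d_def by (intro nonzero_eq_divide_eq[THEN iffD1]) auto
  finally have small: "(\<Sum>f\<in>J. (f (D a))\<^sup>2) < (\<epsilon> / 2)\<^sup>2" using a(3) by simp
  obtain f where f: "f \<in> J" "norm (D a) \<le> \<bar>f (D a)\<bar> + \<epsilon> / 2"
    using J(4)[OF DK[OF a(1)]] by blast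
  have "(f (D a))\<^sup>2 \<le> (\<Sum>f\<in>J. (f (D a))\<^sup>2)"
    using J(1) f(1) by (intro member_le_sum) auto
  with small have "\<bar>f (D a)\<bar>\<^sup>2 < (\<epsilon> / 2)\<^sup>2" by simp
  then have "\<bar>f (D a)\<bar> < \<epsilon> / 2" by (rule power2_less_imp_less) (use \<epsilon> in simp)
  with f(2) have "norm (D a) < \<epsilon>" by simp
  then show "\<exists>e1 e2. mc_fragments e e1 e2 \<and> norm (T e1 - T e2) < \<epsilon>"
    using mc_fragments_fragment_part[OF a(1)] unfolding D_def S_def by blast
qed

end
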